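(* Let $0<|q|<1$, let $m,n$ be positive integers, write $n=3^s n'$ with $\gcd(3,n')=1$, and let $k$ be the multiplicative order of $3$ modulo $n'$ (i.e. the order of $3$ in $\mathbb Z_{n'}$). Fix a sign $\pm$ (the same throughout). Then, whenever all terms are defined, \begin{align*} 2\mathcal{S}(\pm q^m;q^n)+\frac{n-2m}{n} &=\sum_{j=1}^{s+k}\frac{3^{k-j}}{3^k-1}\,\mathcal{P}(-q^{3^{j-1}\cdot 2m};q^n)-\sum_{j=1}^{s}\frac{3^{-j}}{3^k-1}\,\mathcal{P}(-q^{3^{j-1}\cdot 2m};q^n)\\ &\qquad+\mathcal{P}(\pm q^m,\pm q^m,-q^{n-2m};q^n). \end{align*}
   Context: For a base $p$ with $|p|<1$: $(a;p)_\infty=\prod_{i\ge0}(1-ap^i)$, $[a;p]_\infty=(a;p)_\infty(p/a;p)_\infty$, $[a_1,\ldots,a_k;p]_\infty=\prod_i[a_i;p]_\infty$. Define $\mathcal{S}(a;p)=\sum_{i=0}^\infty\left(\frac{1}{1-ap^i}-\frac{1}{1-a^{-1}p^{i+1}}\right)$, $\mathcal P(a,b,c;p)=\frac{[ab,bc,ca;p]_\infty(p;p)_\infty^2}{[a,b,c,abc;p]_\infty}$, and $\mathcal P(a;p)=\mathcal P(a,a,a;p)$. *)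

theory Defs
  imports "HOL-Analysis.Analysis" "HOL-Number_Theory.Number_Theory"
begin

definition qpoch_inf :: "complex \<Rightarrow> complex \<Rightarrow> complex" where
  "qpoch_inf a p = (\<Prod>i. 1 - a * p ^ i)"

definition theta :: "complex \<Rightarrow> complex \<Rightarrow> complex" where
  "theta a p = qpoch_inf a p * qpoch_inf (p / a) p"

definition thetas :: "complex list \<Rightarrow> complex \<Rightarrow> complex" where
  "thetas as p = (\<Prod>a\<leftarrow>as. theta a p)"

definition S_fun :: "complex \<Rightarrow> complex \<Rightarrow> complex" where
  "S_fun a p = (\<Sum>i. 1 / (1 - a * p ^ i) - 1 / (1 - inverse a * p ^ (i + 1)))"

definition P_fun :: "complex \<Rightarrow> complex \<Rightarrow> complex \<Rightarrow> complex \<Rightarrow> complex" where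
  "P_fun a b c p =
     thetas [a * b, b * c, c * a] p * (qpoch_inf p p)\<^sup>2 / thetas [a, b, c, a * b * c] p"

definition P1_fun :: "complex \<Rightarrow> complex \<Rightarrow> complex" where
  "P1_fun a p = P_fun a a a p"

(* Division is total here (x / 0 = 0), so "the term is defined" is spelled out as
   the nonvanishing of everything that is inverted.  For 0 < |p| < 1 the series and
   products converge without further conditions. *)

definition S_defined :: "complex \<Rightarrow> complex \<Rightarrow> bool" where
  "S_defined a p \<longleftrightarrow>
     a \<noteq> 0 \<and> (\<forall>i. 1 - a * p ^ i \<noteq> 0 \<and> 1 - inverse a * p ^ (i + 1) \<noteq> 0)"

definition P_defined :: "complex \<Rightarrow> complex \<Rightarrow> complex \<Rightarrow> complex \<Rightarrow> bool" where
  "P_defined a b c p \<longleftrightarrow>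
     a \<noteq> 0 \<and> b \<noteq> 0 \<and> c \<noteq> 0 \<and> thetas [a, b, c, a * b * c] p \<noteq> 0"

definition P1_defined :: "complex \<Rightarrow> complex \<Rightarrow> bool" where
  "P1_defined a p \<longleftrightarrow> P_defined a a a p"

end

theory Submission
  imports Defs "HOL-Complex_Analysis.Complex_Analysis"
begin

text \<open>
  Up to the constant \<open>1/2\<close>, \<open>S(a;p)\<close> is the logarithmic derivative
  \<open>- a \<theta>'(a) / \<theta>(a)\<close> of \<open>\<theta>(a) = [a;p]\<^sub>\<infinity>\<close>. Hence \<open>\<psi>(a) = S(a;p) + 1/2\<close>
  satisfies \<open>\<psi>(pa) = \<psi>(a) + 1\<close> and \<open>\<psi>(1/a) = - \<psi>(a)\<close>, and Liouville's theorem on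
  the torus \<open>\<complex>\<^sup>* / p\<^sup>\<int>\<close> gives
  \<open>\<psi>(a) + \<psi>(b) + \<psi>(c) - \<psi>(abc) = P(a,b,c;p)\<close>.
  Now let \<open>p = q\<^sup>n\<close>. Taking \<open>a = b = \<plusminus> q\<^sup>m\<close> and \<open>c = - q\<^bsup>n-2m\<^esup>\<close>, so that \<open>abc = - p\<close>,
  expresses \<open>2 S(a;p)\<close> through \<open>\<psi>(- q\<^bsup>2m\<^esup>)\<close> and the last term. Taking \<open>a = b = c\<close> shows that
  \<open>g\<^sub>j = \<psi>(- q\<^bsup>e\<^esup>) - e/n\<close> with \<open>e = 3\<^sup>j \<cdot> 2m\<close> satisfies
  \<open>P(- q\<^bsup>e\<^esup>;p) = 3 g\<^sub>j - g\<^bsub>j+1\<^esub>\<close>. As \<open>g\<^sub>j\<close> depends only on \<open>e\<close> modulo \<open>n\<close>, we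
  have \<open>g\<^bsub>s+k\<^esub> = g\<^sub>s\<close>, and telescoping the two sums leaves \<open>g\<^sub>0\<close>.
\<close>

text \<open>Near a zero \<open>a\<close> of \<open>g\<close>, dividing \<open>f\<close> and
  \<open>g\<close> by \<open>z - a\<close> replaces them by holomorphic functions whose values at
  \<open>a\<close> are the derivatives there. The new denominator is nonzero at \<open>a\<close>, so
  the quotient is holomorphic nearby.\<close>

lemma holomorphic_quotient_simple_zeros:
  fixes f g :: "complex \<Rightarrow> complex"
  assumes f: "f holomorphic_on S" and g: "g holomorphic_on S" and S: "open S"
    and zeros: "\<And>z. z \<in> S \<Longrightarrow> g z = 0 \<Longrightarrow> f z = 0 \<and> deriv g z \<noteq> 0"
  shows "(\<lambda>z. if g z = 0 then deriv f z / deriv g z else f z / g z) holomorphic_on S"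
    (is "?h holomorphic_on S")
proof -
  have "?h field_differentiable at a" if a: "a \<in> S" for a
  proof -
    have "\<exists>f1 g1. f1 holomorphic_on S \<and> g1 holomorphic_on S \<and> g1 a \<noteq> 0 \<and>
                  (\<forall>z\<in>S. g1 z \<noteq> 0 \<longrightarrow> f1 z / g1 z = ?h z)"
    proof (cases "g a = 0")
      case True
      let ?q = "\<lambda>f z. if z = a then deriv f a else (f z - f a) / (z - a)"
      have "?q f holomorphic_on S" "?q g holomorphic_on S"
        using pole_lemma[OF f, of a] pole_lemma[OF g, of a] a S by (simp_all add: interior_open)
      thus ?thesis
        using zeros[OF a True] True by (intro exI[of _ "?q f"] exI[of _ "?q g"]) auto
    next
      case False
      thus ?thesis using f g by (intro exI[of _ f] exI[of _ g]) auto
    qed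
    then obtain f1 g1 where h1: "f1 holomorphic_on S" "g1 holomorphic_on S" "g1 a \<noteq> 0"
      "\<And>z. z \<in> S \<Longrightarrow> g1 z \<noteq> 0 \<Longrightarrow> f1 z / g1 z = ?h z" by blast
    define U where "U = S \<inter> g1 -` (- {0})"
    have U: "open U" "a \<in> U"
      unfolding U_def using h1 a S
      by (auto intro!: continuous_open_preimage holomorphic_on_imp_continuous_on)
    have "(\<lambda>z. f1 z / g1 z) holomorphic_on U"
      by (intro holomorphic_on_divide holomorphic_on_subset[OF h1(1)] holomorphic_on_subset[OF h1(2)])
         (auto simp: U_def)
    hence "?h holomorphic_on U"
      by (rule holomorphic_transform) (use h1 in \<open>auto simp: U_def\<close>)
    thus ?thesis using U by (rule holomorphic_on_imp_differentiable_at)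
  qed
  thus ?thesis
    by (rule holomorphic_onI[OF field_differentiable_at_within])
qed

section \<open>The infinite product as an entire function of its first argument\<close>

context
  fixes p :: complex
  assumes norm_p: "norm p < 1" and p_nz: "p \<noteq> 0"
begin

lemma convergent_prod_qpoch: "convergent_prod (\<lambda>i. 1 - a * p ^ i)"
proof -
  have "summable (\<lambda>i. norm a * norm p ^ i)"
    using norm_p by (intro summable_mult summable_geometric) auto
  hence "summable (\<lambda>i. norm (1 - a * p ^ i - 1))"
    by (simp add: norm_mult norm_power)
  hence "abs_convergent_prod (\<lambda>i. 1 - a * p ^ i)"
    by (rule summable_imp_abs_convergent_prod)
  thus ?thesis by (rule abs_convergent_prod_imp_convergent_prod)
qed

lemma qpoch_inf_eq_0_iff: "qpoch_inf a p = 0 \<longleftrightarrow> (\<exists>i. a * p ^ i = 1)"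
proof -
  have "(\<lambda>i. 1 - a * p ^ i) has_prod qpoch_inf a p"
    unfolding qpoch_inf_def using convergent_prod_qpoch by blast
  hence "qpoch_inf a p = 0 \<longleftrightarrow> 0 \<in> range (\<lambda>i. 1 - a * p ^ i)"
    by (rule has_prod_eq_0_iff)
  thus ?thesis by (auto simp: image_iff)
qed

lemma qpoch_inf_shift: "qpoch_inf a p = (1 - a) * qpoch_inf (a * p) p"
proof (cases "a = 1")
  case True
  then show ?thesis
    using qpoch_inf_eq_0_iff[of 1] by (auto intro!: exI[of _ 0])
next
  case False
  thus ?thesis
    using prodinf_split_head[OF convergent_prod_qpoch[of a]]
    by (simp add: qpoch_inf_def mult_ac)
qed

text \<open>On the disc the k-th factor differs from 1 by at most \<open>R * norm p ^ k\<close>.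
  Uniformity lets holomorphy and logarithmic derivatives pass from the finite products to the
  limit.\<close>

lemma uniform_limit_qpoch_inf:
  "uniform_limit (cball 0 R) (\<lambda>n a. \<Prod>k<n. 1 - a * p ^ k) (\<lambda>a. qpoch_inf a p) sequentially"
proof -
  have "uniformly_convergent_on (cball 0 R) (\<lambda>n a. \<Sum>k<n. norm (1 - a * p ^ k - 1))"
  proof (rule Weierstrass_m_test')
    show "summable (\<lambda>k. R * norm p ^ k)"
      using norm_p by (intro summable_mult summable_geometric) auto
  qed (auto simp: norm_mult norm_power intro!: mult_right_mono)
  hence "uniformly_convergent_on (cball 0 R) (\<lambda>n a. \<Prod>k<n. 1 - a * p ^ k)"
    by (intro uniformly_convergent_on_prod') (auto intro!: continuous_intros)
  then obtain g where g:
    "uniform_limit (cball 0 R) (\<lambda>n a. \<Prod>k<n. 1 - a * p ^ k) g sequentially"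
    by (auto simp: uniformly_convergent_on_def)
  have "g a = qpoch_inf a p" if "a \<in> cball 0 R" for a
  proof -
    have "(\<lambda>n. \<Prod>k<n. 1 - a * p ^ k) \<longlonglongrightarrow> g a"
      using tendsto_uniform_limitI[OF g that] .
    moreover have "(\<lambda>n. \<Prod>k<n. 1 - a * p ^ k) \<longlonglongrightarrow> qpoch_inf a p"
      unfolding qpoch_inf_def LIMSEQ_lessThan_iff_atMost
      by (rule convergent_prod_LIMSEQ[OF convergent_prod_qpoch])
    ultimately show ?thesis by (rule LIMSEQ_unique)
  qed
  thus ?thesis using g by (metis (no_types, lifting) uniform_limit_cong')
qed

lemma holomorphic_qpoch_inf: "(\<lambda>a. qpoch_inf a p) holomorphic_on UNIV"
proof (rule holomorphic_uniform_sequence[where f = "\<lambda>n a. \<Prod>k<n. 1 - a * p ^ k"])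
  show "\<exists>d>0. cball x d \<subseteq> UNIV \<and>
          uniform_limit (cball x d) (\<lambda>n a. \<Prod>k<n. 1 - a * p ^ k) (\<lambda>a. qpoch_inf a p) sequentially" for x
  proof (intro exI[of _ 1] conjI)
    show "uniform_limit (cball x 1) (\<lambda>n a. \<Prod>k<n. 1 - a * p ^ k) (\<lambda>a. qpoch_inf a p) sequentially"
      by (rule uniform_limit_on_subset[OF uniform_limit_qpoch_inf[of "norm x + 1"]])
         (simp add: cball_subset_cball_iff dist_norm)
  qed auto
  show "(\<lambda>a. \<Prod>k<n. 1 - a * p ^ k) holomorphic_on UNIV" for n
    by (intro holomorphic_intros)
qed auto

lemma DERIV_qpoch_inf:
  "((\<lambda>a. qpoch_inf a p) has_field_derivative deriv (\<lambda>a. qpoch_inf a p) x) (at x)"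
  by (rule holomorphic_derivI[OF holomorphic_qpoch_inf open_UNIV UNIV_I])

text \<open>The k-th factor contributes \<open>- x * p ^ k / (1 - x * p ^ k)\<close>, rewritten so
  that the ones cancel when two such series are subtracted to give \<open>S_fun\<close>.\<close>

lemma logderiv_qpoch_inf:
  assumes "qpoch_inf x p \<noteq> 0"
  shows "(\<lambda>k. 1 - 1 / (1 - x * p ^ k)) sums (x * deriv (\<lambda>a. qpoch_inf a p) x / qpoch_inf x p)"
proof -
  have "(\<lambda>k. deriv (\<lambda>a. 1 - a * p ^ k) x / (1 - x * p ^ k)) sums
          (deriv (\<lambda>a. qpoch_inf a p) x / qpoch_inf x p)"
  proof (rule logderiv_prodinf_complex_uniform_limit)
    show "uniform_limit (ball 0 (norm x + 1)) (\<lambda>n a. \<Prod>k<n. 1 - a * p ^ k) (\<lambda>a. qpoch_inf a p) sequentially"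
      by (rule uniform_limit_on_subset[OF uniform_limit_qpoch_inf ball_subset_cball])
  qed (use assms in \<open>auto intro!: holomorphic_intros\<close>)
  hence "(\<lambda>k. x * (deriv (\<lambda>a. 1 - a * p ^ k) x / (1 - x * p ^ k))) sums
          (x * (deriv (\<lambda>a. qpoch_inf a p) x / qpoch_inf x p))"
    by (rule sums_mult)
  moreover have "x * (deriv (\<lambda>a. 1 - a * p ^ k) x / (1 - x * p ^ k)) = 1 - 1 / (1 - x * p ^ k)" for k
  proof -
    have "1 - x * p ^ k \<noteq> 0"
      using assms by (auto simp: qpoch_inf_eq_0_iff)
    moreover have "deriv (\<lambda>a. 1 - a * p ^ k) x = - (p ^ k)"
      by (rule DERIV_imp_deriv) (auto intro!: derivative_eq_intros)
    ultimately show ?thesis by (simp add: field_simps)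
  qed
  ultimately show ?thesis by simp
qed

section \<open>Zeros, functional equations and derivative of theta\<close>

lemma theta_eq_0_imp:
  assumes "theta a p = 0" "a \<noteq> 0"
  obtains k :: int where "a = p powi k"
proof -
  from assms(1) consider i where "a * p ^ i = 1" | i where "p / a * p ^ i = 1"
    by (auto simp: theta_def qpoch_inf_eq_0_iff)
  thus ?thesis
  proof cases
    case 1
    hence "a = p powi (- int i)"
      using p_nz by (simp add: power_int_minus field_simps)
    thus ?thesis by (rule that)
  next
    case 2
    hence "a = p ^ Suc i"
      using assms(2) by (simp add: field_simps)
    hence "a = p powi int (Suc i)"
      by (simp only: power_int_of_nat)
    thus ?thesis by (rule that)
  qed
qed

lemma theta_shift:
  assumes "a \<noteq> 0"
  shows "theta (p * a) p = - theta a p / a"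
proof -
  have "theta a p = (1 - a) * qpoch_inf (a * p) p * qpoch_inf (p / a) p"
    by (simp add: theta_def qpoch_inf_shift[of a])
  moreover have "theta (p * a) p = qpoch_inf (a * p) p * ((1 - 1 / a) * qpoch_inf (p / a) p)"
    using p_nz assms by (simp add: theta_def qpoch_inf_shift[of "1 / a"] mult.commute)
  ultimately show ?thesis using assms by (simp add: divide_simps) (simp add: algebra_simps)
qed

text \<open>Up to order, theta has the same two factors at \<open>1 / a\<close> and at
  \<open>p * a\<close>.\<close>

lemma theta_inverse:
  assumes "a \<noteq> 0"
  shows "theta (1 / a) p = - theta a p / a"
proof -
  have "theta (1 / a) p = theta (p * a) p"
    using p_nz assms by (simp add: theta_def mult.commute)
  thus ?thesis using theta_shift[OF assms] by simp
qed

lemma DERIV_theta_aux: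
  assumes "a \<noteq> 0"
  shows "((\<lambda>x. theta x p) has_field_derivative
     (deriv (\<lambda>a. qpoch_inf a p) a * qpoch_inf (p / a) p
       - p / a\<^sup>2 * deriv (\<lambda>a. qpoch_inf a p) (p / a) * qpoch_inf a p)) (at a)"
proof -
  have "((\<lambda>x. p / x) has_field_derivative - (p / a\<^sup>2)) (at a)"
    using assms by (auto intro!: derivative_eq_intros simp: power2_eq_square)
  from DERIV_mult[OF DERIV_qpoch_inf DERIV_chain2[OF DERIV_qpoch_inf this]]
  show ?thesis by (simp add: theta_def[abs_def] mult_ac)
qed

lemma holomorphic_theta: "(\<lambda>a. theta a p) holomorphic_on - {0}"
proof (rule holomorphic_onI)
  fix a :: complex
  assume "a \<in> - {0}"
  hence "a \<noteq> 0" by simp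
  from DERIV_theta_aux[OF this] have "(\<lambda>a. theta a p) field_differentiable at a"
    unfolding field_differentiable_def by (rule exI)
  thus "(\<lambda>a. theta a p) field_differentiable at a within - {0}"
    by (rule field_differentiable_at_within)
qed

lemma DERIV_theta:
  assumes "a \<noteq> 0"
  shows "((\<lambda>x. theta x p) has_field_derivative deriv (\<lambda>x. theta x p) a) (at a)"
  unfolding DERIV_imp_deriv[OF DERIV_theta_aux[OF assms]] by (rule DERIV_theta_aux[OF assms])

text \<open>The factor \<open>qpoch_inf a p\<close> vanishes at 1, so only its derivative
  contributes, read off after splitting off \<open>1 - a\<close>. This value is the source of
  \<open>(qpoch_inf p p)\<^sup>2\<close> in \<open>P_fun\<close>.\<close>

lemma deriv_theta_1: "deriv (\<lambda>x. theta x p) 1 = - (qpoch_inf p p)\<^sup>2"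
proof -
  have "qpoch_inf 1 p = 0"
    by (simp add: qpoch_inf_shift[of 1])
  moreover have "deriv (\<lambda>a. qpoch_inf a p) 1 = - qpoch_inf p p"
  proof (rule DERIV_imp_deriv)
    have "((\<lambda>a. (1 - a) * qpoch_inf (a * p) p) has_field_derivative - qpoch_inf p p) (at 1)"
      by (auto intro!: derivative_eq_intros DERIV_chain2[OF DERIV_qpoch_inf])
    thus "((\<lambda>a. qpoch_inf a p) has_field_derivative - qpoch_inf p p) (at 1)"
      by (simp flip: qpoch_inf_shift)
  qed
  ultimately show ?thesis
    using DERIV_imp_deriv[OF DERIV_theta_aux[of 1]] by (simp add: power2_eq_square)
qed

lemma qpoch_inf_self_nonzero: "qpoch_inf p p \<noteq> 0"
proof
  assume "qpoch_inf p p = 0"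
  then obtain i where "p ^ Suc i = 1" by (auto simp: qpoch_inf_eq_0_iff)
  hence "norm p ^ Suc i = 1" by (metis norm_one norm_power)
  thus False using norm_p power_Suc_less_one[of "norm p" i] p_nz by auto
qed

section \<open>The function \<open>psi\<close> under multiplication by \<open>p\<close> and
  inversion\<close>

text \<open>The regularisation \<open>\<psi> \<theta>\<close>, which stays holomorphic at the zeros of \<open>\<theta>\<close>.\<close>

definition theta_D :: "complex \<Rightarrow> complex" where
  "theta_D a = theta a p / 2 - a * deriv (\<lambda>x. theta x p) a"

definition psi :: "complex \<Rightarrow> complex" where
  "psi a = S_fun a p + 1 / 2"

lemma psi_eq:
  assumes "a \<noteq> 0" "theta a p \<noteq> 0"
  shows "psi a = theta_D a / theta a p"
proof -
  let ?Q = "\<lambda>a. qpoch_inf a p"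
  have nz: "?Q a \<noteq> 0" "?Q (p / a) \<noteq> 0"
    using assms by (auto simp: theta_def)
  have "(\<lambda>k. (1 - 1 / (1 - (p / a) * p ^ k)) - (1 - 1 / (1 - a * p ^ k))) sums
          (p / a * deriv ?Q (p / a) / ?Q (p / a) - a * deriv ?Q a / ?Q a)"
    by (intro sums_diff logderiv_qpoch_inf nz)
  also have "(\<lambda>k. (1 - 1 / (1 - (p / a) * p ^ k)) - (1 - 1 / (1 - a * p ^ k))) =
             (\<lambda>i. 1 / (1 - a * p ^ i) - 1 / (1 - inverse a * p ^ (i + 1)))"
    by (simp add: field_simps)
  finally have "S_fun a p = p / a * deriv ?Q (p / a) / ?Q (p / a) - a * deriv ?Q a / ?Q a"
    unfolding S_fun_def by (rule sums_unique[symmetric])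
  also have "\<dots> = - (a * deriv (\<lambda>x. theta x p) a) / theta a p"
    unfolding DERIV_imp_deriv[OF DERIV_theta_aux[OF assms(1)]]
    unfolding theta_def using nz assms
    by (simp add: divide_simps) (simp add: algebra_simps power2_eq_square)
  finally show ?thesis using assms by (simp add: psi_def theta_D_def diff_divide_distrib)
qed

lemma DERIV_minus_theta_over:
  assumes "a \<noteq> 0"
  shows "((\<lambda>x. - theta x p / x) has_field_derivative
           - deriv (\<lambda>x. theta x p) a / a + theta a p / a\<^sup>2) (at a)"
  using DERIV_divide[OF DERIV_minus[OF DERIV_theta[OF assms]] DERIV_ident assms] assms
  by (simp add: diff_divide_distrib power2_eq_square)

lemma deriv_theta_shift:
  assumes "a \<noteq> 0"
  shows "p * deriv (\<lambda>x. theta x p) (p * a) = - deriv (\<lambda>x. theta x p) a / a + theta a p / a\<^sup>2"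
proof (rule DERIV_unique)
  have "((\<lambda>x. p * x) has_field_derivative p) (at a)"
    by (auto intro!: derivative_eq_intros)
  from DERIV_chain2[OF DERIV_theta this]
  show "((\<lambda>x. theta (p * x) p) has_field_derivative p * deriv (\<lambda>x. theta x p) (p * a)) (at a)"
    using assms p_nz by (simp add: mult.commute)
  have "((\<lambda>x. - theta x p / x) has_field_derivative
          - deriv (\<lambda>x. theta x p) a / a + theta a p / a\<^sup>2) (at a)"
    by (rule DERIV_minus_theta_over)  (rule assms)
  thus "((\<lambda>x. theta (p * x) p) has_field_derivative
          - deriv (\<lambda>x. theta x p) a / a + theta a p / a\<^sup>2) (at a)"
    by (rule has_field_derivative_transform_within_open[of _ _ _ "- {0}"])
       (use assms theta_shift in auto)
qed

lemma deriv_theta_inverse: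
  assumes "a \<noteq> 0"
  shows "deriv (\<lambda>x. theta x p) (1 / a) = a * deriv (\<lambda>x. theta x p) a - theta a p"
proof -
  have "((\<lambda>x. theta (1 / x) p) has_field_derivative - deriv (\<lambda>x. theta x p) (1 / a) / a\<^sup>2) (at a)"
  proof -
    have "((\<lambda>x. 1 / x) has_field_derivative - (1 / a\<^sup>2)) (at a)"
      using assms by (auto intro!: derivative_eq_intros simp: power2_eq_square)
    from DERIV_chain2[OF DERIV_theta this] show ?thesis using assms by simp
  qed
  moreover have "((\<lambda>x. - theta x p / x) has_field_derivative
          - deriv (\<lambda>x. theta x p) a / a + theta a p / a\<^sup>2) (at a)"
    by (rule DERIV_minus_theta_over)  (rule assms)
  hence "((\<lambda>x. theta (1 / x) p) has_field_derivative
          - deriv (\<lambda>x. theta x p) a / a + theta a p / a\<^sup>2) (at a)"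
    by (rule has_field_derivative_transform_within_open[of _ _ _ "- {0}"])
       (use assms theta_inverse in auto)
  ultimately have "- deriv (\<lambda>x. theta x p) (1 / a) / a\<^sup>2 = - deriv (\<lambda>x. theta x p) a / a + theta a p / a\<^sup>2"
    by (rule DERIV_unique)
  thus ?thesis using assms by (simp add: field_simps power2_eq_square)
qed

lemma theta_D_shift:
  assumes "a \<noteq> 0"
  shows "theta_D (p * a) = - (theta_D a + theta a p) / a"
proof -
  have "theta_D (p * a) = theta (p * a) p / 2 - a * (p * deriv (\<lambda>x. theta x p) (p * a))"
    by (simp add: theta_D_def)
  thus ?thesis
    using assms by (simp add: deriv_theta_shift theta_shift)
       (simp add: theta_D_def field_simps power2_eq_square)
qed

lemma theta_D_inverse:
  assumes "a \<noteq> 0"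
  shows "theta_D (1 / a) = theta_D a / a"
  using assms by (simp add: theta_D_def deriv_theta_inverse theta_inverse field_simps)

lemma psi_shift:
  assumes "a \<noteq> 0" "theta a p \<noteq> 0"
  shows "psi (p * a) = psi a + 1"
proof -
  have "psi (p * a) = theta_D (p * a) / theta (p * a) p"
    using assms p_nz by (intro psi_eq) (auto simp: theta_shift)
  also have "\<dots> = theta_D a / theta a p + 1"
    unfolding theta_shift[OF assms(1)] theta_D_shift[OF assms(1)]
    using assms by (simp add: field_simps)
  finally show ?thesis using assms by (simp add: psi_eq)
qed

lemma psi_inverse:
  assumes "a \<noteq> 0" "theta a p \<noteq> 0"
  shows "psi (1 / a) = - psi a"
proof -
  have "psi (1 / a) = theta_D (1 / a) / theta (1 / a) p"
    using assms by (intro psi_eq) (auto simp: theta_inverse)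
  thus ?thesis
    using assms by (simp add: psi_eq theta_inverse theta_D_inverse)
qed

section \<open>All integer powers of \<open>p\<close>; simplicity of the zeros of theta\<close>

text \<open>For negative \<open>k\<close>, a positive power of \<open>p\<close> leads from
  \<open>p powi k * x\<close> back to \<open>x\<close>. An arbitrary predicate covers vanishing as
  well as equality of values.\<close>

lemma powi_mult_induct:
  assumes step: "\<And>a. a \<noteq> 0 \<Longrightarrow> Q (p * a) \<longleftrightarrow> Q a" and "x \<noteq> 0"
  shows "Q (p powi k * x) \<longleftrightarrow> Q x"
proof -
  have nat: "Q (p ^ n * y) \<longleftrightarrow> Q y" if "y \<noteq> 0" for n y
  proof (induction n)
    case (Suc n)
    have "p ^ n * y \<noteq> 0" using that p_nz by simp
    from step[OF this] Suc show ?case by (simp add: mult.assoc)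
  qed simp
  show ?thesis
  proof (cases k)
    case (nonneg n)
    thus ?thesis using nat[OF assms(2)] by simp
  next
    case (neg n)
    have "p ^ Suc n * (p powi k * x) = x"
      unfolding neg using p_nz
      by (simp only: power_int_minus power_int_of_nat) (simp add: field_simps)
    with nat[of "p powi k * x" "Suc n"] show ?thesis
      using assms(2) p_nz by (simp del: power_Suc)
  qed
qed

lemma theta_1: "theta 1 p = 0"
  using qpoch_inf_eq_0_iff[of 1] by (auto simp: theta_def intro!: exI[of _ 0])

lemma theta_powi_mult_eq_0_iff:
  assumes "x \<noteq> 0"
  shows "theta (p powi k * x) p = 0 \<longleftrightarrow> theta x p = 0"
  by (rule powi_mult_induct[OF _ assms]) (simp add: theta_shift)

text \<open>The zero is moved to 1, where the derivative is known. Vanishing and nonzero derivative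
  are transported together, since the extra term in \<open>deriv_theta_shift\<close> disappears only
  at a zero.\<close>

lemma deriv_theta_nonzero:
  assumes "theta a p = 0" "a \<noteq> 0"
  shows "deriv (\<lambda>x. theta x p) a \<noteq> 0"
proof -
  obtain k where k: "a = p powi k * 1"
    using theta_eq_0_imp[OF assms] by auto
  have "theta (p powi k * 1) p = 0 \<and> deriv (\<lambda>x. theta x p) (p powi k * 1) \<noteq> 0 \<longleftrightarrow>
        theta 1 p = 0 \<and> deriv (\<lambda>x. theta x p) 1 \<noteq> 0"
  proof (rule powi_mult_induct)
    fix a :: complex
    assume "a \<noteq> 0"
    thus "theta (p * a) p = 0 \<and> deriv (\<lambda>x. theta x p) (p * a) \<noteq> 0 \<longleftrightarrow>
          theta a p = 0 \<and> deriv (\<lambda>x. theta x p) a \<noteq> 0"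
      using deriv_theta_shift[of a] theta_shift[of a] p_nz by auto
  qed simp
  thus ?thesis
    using k theta_1 deriv_theta_1 qpoch_inf_self_nonzero by simp
qed

lemma psi_powi_mult:
  assumes "x \<noteq> 0" "theta x p \<noteq> 0"
  shows "psi (p powi k * x) = psi x + of_int k"
proof -
  have nat: "psi (p ^ n * y) = psi y + of_nat n" if "y \<noteq> 0" "theta y p \<noteq> 0" for n y
  proof (induction n)
    case (Suc n)
    have "p ^ n * y \<noteq> 0" "theta (p ^ n * y) p \<noteq> 0"
      using theta_powi_mult_eq_0_iff[of y "int n"] that p_nz by auto
    from psi_shift[OF this] Suc show ?case by (simp add: mult.assoc add_ac)
  qed simp
  show ?thesis
  proof (cases k)
    case (nonneg n)
    thus ?thesis using nat[OF assms] by simp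
  next
    case (neg n)
    have "p ^ Suc n * (p powi k * x) = x"
      unfolding neg using p_nz
      by (simp only: power_int_minus power_int_of_nat) (simp add: field_simps)
    moreover have "psi (p ^ Suc n * (p powi k * x)) = psi (p powi k * x) + of_nat (Suc n)"
      using assms p_nz by (intro nat) (auto simp: theta_powi_mult_eq_0_iff)
    ultimately have "psi x = psi (p powi k * x) + of_nat (Suc n)"
      by (simp only:)
    thus ?thesis by (simp add: neg)
  qed
qed

section \<open>Liouville's theorem on the torus and the addition formula\<close>

text \<open>All values on nonzero arguments are attained on the compact annulus between radii
  \<open>norm p\<close> and 1, so composing with \<open>exp\<close>, which reaches every nonzero
  number, yields a bounded entire function.\<close>

lemma multiplicatively_periodic_constant:
  assumes holo: "h holomorphic_on - {0}"
    and per: "\<And>a. a \<noteq> 0 \<Longrightarrow> h (p * a) = h a"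
  obtains c where "\<And>a. a \<noteq> 0 \<Longrightarrow> h a = c"
proof -
  define A where "A = cball (0::complex) 1 - ball 0 (norm p)"
  have "compact A"
    unfolding A_def by (intro compact_diff) auto
  moreover have "continuous_on A h"
    by (rule holomorphic_on_imp_continuous_on[OF holomorphic_on_subset[OF holo]])
       (use p_nz in \<open>auto simp: A_def\<close>)
  ultimately have bdd: "bounded (h ` A)"
    by (intro compact_imp_bounded compact_continuous_image)
  have "h a \<in> h ` A" if "a \<noteq> 0" for a
  proof -
    define L where "L = - ln (norm p)"
    have L: "L > 0" unfolding L_def using norm_p p_nz by simp
    \<comment> \<open>Rounding up gives \<open>- L \<le> ln (norm a) - k * L \<le> 0\<close>, which
      puts \<open>p powi k * a\<close> into the annulus.\<close>
    define k where "k = \<lceil>ln (norm a) / L\<rceil>"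
    have "ln (norm a) / L \<le> k" "k \<le> ln (norm a) / L + 1"
      unfolding k_def by linarith+
    hence k: "ln (norm a) \<le> k * L" "k * L \<le> ln (norm a) + L"
      using L by (auto simp: field_simps)
    have "norm (p powi k * a) = norm p powr k * norm a"
      using p_nz by (simp add: norm_mult norm_power_int powr_real_of_int')
    also have "\<dots> = exp (ln (norm a) - k * L)"
      using p_nz that by (simp add: powr_def L_def exp_diff exp_minus exp_add field_simps)
    finally have norm: "norm (p powi k * a) = exp (ln (norm a) - k * L)" .
    have "norm p = exp (- L)" using p_nz by (simp add: L_def)
    hence "p powi k * a \<in> A"
      using norm k by (simp add: A_def)
    moreover have "h (p powi k * a) = h a \<longleftrightarrow> h a = h a"
      by (rule powi_mult_induct) (use per that in auto)
    ultimately show ?thesis by (metis imageI)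
  qed
  hence "range (\<lambda>z. h (exp z)) \<subseteq> h ` A" by auto
  hence "bounded (range (\<lambda>z. h (exp z)))"
    using bdd bounded_subset by blast
  moreover have "(\<lambda>z. h (exp z)) holomorphic_on UNIV"
    using holomorphic_on_compose_gen[OF holomorphic_on_exp holo, of UNIV] by (force simp: o_def)
  ultimately obtain c where c: "\<And>z. h (exp z) = c"
    using Liouville_theorem unfolding constant_on_def by blast
  show ?thesis
    by (rule that[of c]) (metis c exp_Ln)
qed

lemma holomorphic_theta_mult:
  assumes "u \<noteq> 0"
  shows "(\<lambda>x. theta (u * x) p) holomorphic_on - {0}"
proof -
  have "(\<lambda>x. u * x) holomorphic_on - {0}"
    by (intro holomorphic_intros)
  from holomorphic_on_compose_gen[OF this holomorphic_theta] show ?thesis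
    using assms by (force simp: o_def)
qed

lemma holomorphic_theta_D: "theta_D holomorphic_on - {0}"
  unfolding theta_D_def[abs_def]
  by (intro holomorphic_intros holomorphic_theta holomorphic_deriv) auto

lemma holomorphic_theta_D_mult:
  assumes "u \<noteq> 0"
  shows "(\<lambda>x. theta_D (u * x)) holomorphic_on - {0}"
proof -
  have "(\<lambda>x. u * x) holomorphic_on - {0}"
    by (intro holomorphic_intros)
  from holomorphic_on_compose_gen[OF this holomorphic_theta_D] show ?thesis
    using assms by (force simp: o_def)
qed

text \<open>At a zero of \<open>G\<close> the derivative of the factor
  \<open>1 / (u * x\<^sup>2)\<close> drops out. Two functions with this same law have a periodic
  quotient of derivatives at common zeros, as needed at removable singularities.\<close>

lemma deriv_shift_at_zero:
  assumes holo: "G holomorphic_on - {0}" and "u \<noteq> 0" "x \<noteq> 0" "G x = 0"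
    and shift: "\<And>x. x \<noteq> 0 \<Longrightarrow> G (p * x) = G x / (u * x\<^sup>2)"
  shows "p * deriv G (p * x) = deriv G x / (u * x\<^sup>2)"
proof (rule DERIV_unique)
  have G: "(G has_field_derivative deriv G y) (at y)" if "y \<noteq> 0" for y
    by (rule holomorphic_derivI[OF holo]) (use that in auto)
  have "((\<lambda>x. p * x) has_field_derivative p) (at x)"
    by (auto intro!: derivative_eq_intros)
  from DERIV_chain2[OF G this]
  show "((\<lambda>x. G (p * x)) has_field_derivative p * deriv G (p * x)) (at x)"
    using assms p_nz by (simp add: mult.commute)
  have "((\<lambda>x. u * x\<^sup>2) has_field_derivative u * (2 * x)) (at x)"
    by (auto intro!: derivative_eq_intros)
  from DERIV_divide[OF G[OF assms(3)] this]
  have "((\<lambda>x. G x / (u * x\<^sup>2)) has_field_derivative deriv G x / (u * x\<^sup>2)) (at x)"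
    using assms by (simp add: field_simps power2_eq_square)
  thus "((\<lambda>x. G (p * x)) has_field_derivative deriv G x / (u * x\<^sup>2)) (at x)"
    by (rule has_field_derivative_transform_within_open[of _ _ _ "- {0}"])
       (use assms in auto)
qed

lemma psi_sum_eq_P_fun:
  assumes nz: "a \<noteq> 0" "b \<noteq> 0" "c \<noteq> 0"
    and theta_nz: "theta a p \<noteq> 0" "theta b p \<noteq> 0" "theta c p \<noteq> 0" "theta (a * b * c) p \<noteq> 0"
  shows "psi a + psi b + psi c - psi (a * b * c) = P_fun a b c p"
\<comment> \<open>If \<open>b * c\<close> is a power of \<open>p\<close>, the zeros of the two
  factors of \<open>T\<close> below would coincide, so this case is treated apart; both sides are
  then 0.\<close>
proof (cases "theta (b * c) p = 0")
  case True
  then obtain k where k: "b * c = p powi k"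
    using theta_eq_0_imp nz by (metis mult_eq_0_iff)
  have "psi (a * b * c) = psi (p powi k * a)"
    using k by (simp add: mult_ac)
  also have "\<dots> = psi a + of_int k"
    using nz theta_nz by (intro psi_powi_mult)
  finally have 1: "psi (a * b * c) = psi a + of_int k" .
  have "psi c = psi (p powi k * (1 / b))"
    using nz by (simp flip: k)
  also have "\<dots> = of_int k - psi b"
    using nz theta_nz by (subst psi_powi_mult) (auto simp: theta_inverse psi_inverse)
  finally show ?thesis
    using True 1 by (simp add: P_fun_def thetas_def)
next
  case False
  define u where "u = b * c"
  have u: "u \<noteq> 0" "theta u p \<noteq> 0" using nz False by (auto simp: u_def)
  \<comment> \<open>With \<open>a\<close> replaced by a variable \<open>x\<close>, the claim multiplied by the common denominator \<open>T\<close>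
      reads \<open>F x = 0\<close>. The quotient \<open>F / T\<close> is \<open>p\<close>-periodic with removable singularities, hence
      constant, and it vanishes at \<open>x = 1 / b\<close>.\<close>
  define K where "K = theta u p * (qpoch_inf p p)\<^sup>2 / (theta b p * theta c p)"
  define T where "T = (\<lambda>x. theta x p * theta (u * x) p)"
  define F where "F = (\<lambda>x. (psi b + psi c) * T x + theta_D x * theta (u * x) p
                        - theta x p * theta_D (u * x) - theta (b * x) p * theta (c * x) p * K)"
  have holo_T: "T holomorphic_on - {0}"
    unfolding T_def by (intro holomorphic_intros holomorphic_theta holomorphic_theta_mult u)
  have holo_F: "F holomorphic_on - {0}"
    unfolding F_def
    by (intro holomorphic_intros holo_T holomorphic_theta holomorphic_theta_mult
          holomorphic_theta_D holomorphic_theta_D_mult u nz)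
  have shift: "theta (v * (p * x)) p = - theta (v * x) p / (v * x)"
              "theta_D (v * (p * x)) = - (theta_D (v * x) + theta (v * x) p) / (v * x)"
    if "v \<noteq> 0" "x \<noteq> 0" for v x
    using theta_shift[of "v * x"] theta_D_shift[of "v * x"] that by (simp_all add: mult_ac)
  have shift_T: "T (p * x) = T x / (u * x\<^sup>2)" if "x \<noteq> 0" for x
    using that u by (simp add: T_def shift theta_shift power2_eq_square)
  have shift_F: "F (p * x) = F x / (u * x\<^sup>2)" if "x \<noteq> 0" for x
  proof -
    \<comment> \<open>The extra terms from shifting \<open>theta_D\<close> are both multiples of
      \<open>theta x p * theta (u * x) p\<close> and cancel. The \<open>K\<close> term of
      \<open>F\<close> gets the same factor because
      \<open>(b * x) * (c * x) = u * x\<^sup>2\<close>.\<close>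
    have "theta_D (p * x) * theta (u * (p * x)) p - theta (p * x) p * theta_D (u * (p * x)) =
          (theta_D x * theta (u * x) p - theta x p * theta_D (u * x)) / (u * x\<^sup>2)"
      using that u
      by (simp add: shift theta_shift theta_D_shift power2_eq_square divide_simps)
         (simp add: algebra_simps)
    moreover have "theta (b * (p * x)) p * theta (c * (p * x)) p =
                   theta (b * x) p * theta (c * x) p / (u * x\<^sup>2)"
      using that nz by (simp add: shift u_def power2_eq_square mult_ac)
    ultimately show ?thesis
      by (simp add: F_def shift_T[OF that] add_diff_eq[symmetric] add_divide_distrib
            diff_divide_distrib)
  qed
  have theta_D_1: "theta_D 1 = (qpoch_inf p p)\<^sup>2"
    by (simp add: theta_D_def theta_1 deriv_theta_1)
  \<comment> \<open>At the zeros 1 and \<open>1 / u\<close> of \<open>T\<close>, only one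
    \<open>theta_D\<close> term and the \<open>K\<close> term survive; \<open>K\<close> is exactly
    what makes them cancel.\<close>
  have "F 1 = 0"
    using theta_nz by (simp add: F_def T_def theta_1 theta_D_1 K_def)
  moreover have "F (1 / u) = 0"
  proof -
    have "theta (b * (1 / u)) p = - theta c p / c" "theta (c * (1 / u)) p = - theta b p / b"
      using nz theta_inverse[of b] theta_inverse[of c] by (simp_all add: u_def)
    thus ?thesis
      using nz u theta_nz
      by (simp add: F_def T_def theta_1 theta_D_1 theta_inverse K_def) (simp add: u_def)
  qed
  moreover have "F (p powi k * x) = 0 \<longleftrightarrow> F x = 0" if "x \<noteq> 0" for k x
    by (rule powi_mult_induct[OF _ that]) (use shift_F u in auto)
  ultimately have F_0: "F (p powi k) = 0" "F (p powi k * (1 / u)) = 0" for k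
    using u by (metis mult.right_neutral one_neq_zero, metis divide_eq_0_iff one_neq_zero)
  have zeros: "F x = 0 \<and> deriv T x \<noteq> 0" if "x \<in> - {0}" "T x = 0" for x
  proof -
    have x: "x \<noteq> 0" using that by simp
    have "((\<lambda>x. u * x) has_field_derivative u) (at x)"
      by (auto intro!: derivative_eq_intros)
    from DERIV_mult[OF DERIV_theta[OF x] DERIV_chain2[OF DERIV_theta this]]
    have dT: "deriv T x = deriv (\<lambda>x. theta x p) x * theta (u * x) p
                         + deriv (\<lambda>x. theta x p) (u * x) * u * theta x p"
      using x u unfolding T_def by (intro DERIV_imp_deriv) simp
    from that(2) consider "theta x p = 0" | "theta (u * x) p = 0"
      by (auto simp: T_def)
    thus ?thesis
    proof cases
      case 1
      then obtain k where k: "x = p powi k" using theta_eq_0_imp x by blast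
      \<comment> \<open>Here \<open>theta u p \<noteq> 0\<close> excludes a common zero of the two
        factors, so the zero of \<open>T\<close> is simple.\<close>
      have "theta (u * x) p \<noteq> 0"
        using u theta_powi_mult_eq_0_iff[of u k] by (simp add: k mult.commute)
      thus ?thesis using F_0 k dT 1 deriv_theta_nonzero[OF 1 x] by simp
    next
      case 2
      then obtain k where k: "u * x = p powi k" using theta_eq_0_imp x u by (metis mult_eq_0_iff)
      hence k': "x = p powi k * (1 / u)" using u by (simp add: field_simps)
      have "theta x p \<noteq> 0"
        unfolding k' using u by (subst theta_powi_mult_eq_0_iff) (auto simp: theta_inverse)
      thus ?thesis using F_0 k' dT 2 deriv_theta_nonzero[OF 2] x u by simp
    qed
  qed
  define h where "h = (\<lambda>x. if T x = 0 then deriv F x / deriv T x else F x / T x)"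
  have "h holomorphic_on - {0}"
    unfolding h_def by (rule holomorphic_quotient_simple_zeros[OF holo_F holo_T _ zeros]) auto
  moreover have "h (p * x) = h x" if x: "x \<noteq> 0" for x
  proof (cases "T x = 0")
    case True
    hence "p * deriv F (p * x) = deriv F x / (u * x\<^sup>2)" "p * deriv T (p * x) = deriv T x / (u * x\<^sup>2)"
      using deriv_shift_at_zero[OF holo_F u(1) x _ shift_F]
        deriv_shift_at_zero[OF holo_T u(1) x _ shift_T] zeros[of x] x by simp_all
    hence "(p * deriv F (p * x)) / (p * deriv T (p * x)) = deriv F x / deriv T x"
      using u x by simp
    thus ?thesis using True p_nz shift_T[OF x] by (simp add: h_def)
  next
    case False
    thus ?thesis using shift_T[OF x] shift_F[OF x] u x by (simp add: h_def)
  qed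
  ultimately obtain C where C: "\<And>x. x \<noteq> 0 \<Longrightarrow> h x = C"
    using multiplicatively_periodic_constant by blast
  \<comment> \<open>At \<open>x = 1 / b\<close> the \<open>K\<close> term contains
    \<open>theta 1 p = 0\<close>, and \<open>u * x = c\<close>, so a multiple of
    \<open>psi b + psi c + psi (1 / b) - psi c\<close> remains, which is 0 by oddness.\<close>
  have "theta (1 / b) p \<noteq> 0" "theta_D (1 / b) = psi (1 / b) * theta (1 / b) p"
       "theta_D c = psi c * theta c p"
    using nz theta_nz psi_eq[of "1 / b"] psi_eq[of c] by (simp_all add: theta_inverse)
  hence "F (1 / b) = 0" "T (1 / b) \<noteq> 0"
    using nz theta_nz by (simp_all add: F_def T_def u_def psi_inverse theta_1 algebra_simps)
  hence "C = 0" using C[of "1 / b"] nz by (simp add: h_def)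
  moreover have Ta: "T a \<noteq> 0"
    using theta_nz by (simp add: T_def u_def mult_ac)
  ultimately have "F a = 0"
    using C[of a] nz by (simp add: h_def)
  moreover have "theta_D a = psi a * theta a p"
       "theta_D (u * a) = psi (u * a) * theta (u * a) p"
    using nz u theta_nz Ta psi_eq[of a] psi_eq[of "u * a"] by (simp_all add: T_def)
  ultimately have "(psi a + psi b + psi c - psi (u * a)) * T a = theta (b * a) p * theta (c * a) p * K"
    by (simp add: F_def T_def algebra_simps)
  hence "psi a + psi b + psi c - psi (u * a) = theta (b * a) p * theta (c * a) p * K / T a"
    using Ta by (simp add: field_simps)
  also have "\<dots> = P_fun a b c p"
    by (simp add: P_fun_def thetas_def K_def T_def u_def mult_ac)
  finally show ?thesis by (simp add: u_def mult_ac)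
qed

text \<open>As -1 is its own inverse, oddness forces the value 0. It is no zero of theta: a power of
  \<open>p\<close> of norm 1 has exponent 0 and hence equals 1.\<close>

lemma psi_minus_1: "psi (- 1) = 0" "theta (- 1) p \<noteq> 0"
proof -
  show "theta (- 1) p \<noteq> 0"
  proof
    assume "theta (- 1) p = 0"
    from theta_eq_0_imp[OF this] obtain k where k: "- 1 = p powi k"
      by (metis neg_equal_0_iff_equal one_neq_zero)
    have "norm p powi k = norm (- 1 :: complex)"
      unfolding k by (simp add: norm_power_int)
    hence eq: "norm p powi k = 1" by simp
    have pow: "norm p ^ Suc i \<noteq> 1" for i
      using power_Suc_less_one[of "norm p" i] norm_p p_nz by simp
    have "k = 0"
    proof (cases k)
      case (nonneg i)
      hence "norm p ^ i = 1" using eq by (simp only: power_int_of_nat)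
      thus ?thesis using pow[of "i - 1"] nonneg by (cases "i = 0") simp_all
    next
      case (neg i)
      have "inverse (norm p ^ Suc i) = 1"
        using eq unfolding neg by (simp only: power_int_minus power_int_of_nat)
      thus ?thesis using pow[of i] by (simp del: power_Suc)
    qed
    thus False using k by simp
  qed
  thus "psi (- 1) = 0" using psi_inverse[of "- 1"] by simp
qed

end

section \<open>Specialisation to powers of \<open>q\<close> and the telescoping sum\<close>

theorem theorem3p3:
  fixes q \<epsilon> :: complex and m n s n' k :: nat
  assumes "0 < norm q" and "norm q < 1"
    and "m > 0" and "n > 0"
    and "n = 3 ^ s * n'" and "gcd 3 n' = 1"
    and "k = ord n' 3"
    and "\<epsilon> = 1 \<or> \<epsilon> = -1"
    and "S_defined (\<epsilon> * q ^ m) (q ^ n)"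
    and "\<And>j. j \<in> {1..s + k} \<Longrightarrow>
           P1_defined (- (q ^ (3 ^ (j - 1) * (2 * m)))) (q ^ n)"
    and "P_defined (\<epsilon> * q ^ m) (\<epsilon> * q ^ m) (- (q powi (int n - 2 * int m))) (q ^ n)"
  shows "2 * S_fun (\<epsilon> * q ^ m) (q ^ n) + (of_nat n - 2 * of_nat m) / of_nat n =
      (\<Sum>j = 1..s + k. 3 powi (int k - int j) / (3 ^ k - 1) *
         P1_fun (- (q ^ (3 ^ (j - 1) * (2 * m)))) (q ^ n))
    - (\<Sum>j = 1..s. 3 powi (- int j) / (3 ^ k - 1) *
         P1_fun (- (q ^ (3 ^ (j - 1) * (2 * m)))) (q ^ n))
    + P_fun (\<epsilon> * q ^ m) (\<epsilon> * q ^ m) (- (q powi (int n - 2 * int m))) (q ^ n)"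
proof -
  define p where "p = q ^ n"
  have q: "q \<noteq> 0" using assms(1) by auto
  have p_nz: "p \<noteq> 0" and norm_p: "norm p < 1"
    using assms(1,2,4) by (auto simp: p_def norm_power power_less_one_iff)
  note psi_lemmas = psi_powi_mult[OF norm_p p_nz] psi_sum_eq_P_fun[OF norm_p p_nz]
    psi_inverse[OF norm_p p_nz] psi_shift[OF norm_p p_nz]
  \<comment> \<open>Positivity of \<open>k\<close> keeps \<open>3 ^ k - 1\<close> nonzero and puts 0
    and \<open>s\<close> into the range \<open>j < s + k\<close> where \<open>x_theta\<close>
    applies.\<close>
  have "coprime n' 3"
    unfolding coprime_iff_gcd_eq_1 using assms(6) by (subst gcd.commute)
  hence "k > 0" unfolding assms(7) by (simp only: ord_gt_0_iff)
  define x where "x = (\<lambda>j. - (q ^ (3 ^ j * (2 * m))))"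
  \<comment> \<open>The subtracted term offsets the growth of \<open>psi\<close> by 1 when the
    exponent grows by \<open>n\<close>; it triples with the exponent, so it cancels in
    \<open>3 * g j - g (Suc j)\<close>.\<close>
  define g where "g = (\<lambda>j. psi p (x j) - of_nat (3 ^ j * (2 * m)) / of_nat n)"
  have x_nz: "x j \<noteq> 0" for j using q by (simp add: x_def)
  have x_Suc: "x (Suc j) = x j * x j * x j" for j
    by (simp add: x_def mult_ac flip: power_add)
  \<comment> \<open>The denominator of \<open>P1_fun (x j) p\<close> also contains theta at the cube
    of \<open>x j\<close>, which is \<open>x (Suc j)\<close>.\<close>
  have x_theta: "theta (x j) p \<noteq> 0" "theta (x (Suc j)) p \<noteq> 0" if "j < s + k" for j
    using assms(10)[of "Suc j"] that
    by (simp_all add: P1_defined_def P_defined_def thetas_def x_Suc)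
       (simp_all add: x_def p_def)
  have P1: "P1_fun (x j) p = 3 * g j - g (Suc j)" if "j < s + k" for j
  proof -
    have "psi p (x j) + psi p (x j) + psi p (x j) - psi p (x (Suc j)) = P1_fun (x j) p"
      unfolding x_Suc P1_fun_def
      by (intro psi_lemmas x_nz x_theta(1)[OF that] x_theta(2)[OF that, unfolded x_Suc])
    thus ?thesis by (simp add: g_def field_simps)
  qed
  \<comment> \<open>Each summand equals
    \<open>g (j - 1) / 3 ^ (j - 1) - g j / 3 ^ j\<close>.\<close>
  have telescope: "(\<Sum>j = 1..N. P1_fun (x (j - 1)) p / 3 ^ j) = g 0 - g N / 3 ^ N"
    if "N \<le> s + k" for N
    using that
  proof (induction N)
    case (Suc N)
    thus ?case using P1[of N] by (simp add: diff_divide_distrib)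
  qed simp
  have period: "g (s + k) = g s"
  proof -
    have "[3 ^ k = 1] (mod n')" using ord[of 3 n'] assms(7) by simp
    hence "[1 = 3 ^ k] (mod n')" by (rule cong_sym)
    then obtain t where t: "3 ^ k = 1 + t * n'"
      by (metis cong_to_1_nat cong_sym dvd_def mult.commute le_add_diff_inverse one_le_power
            one_le_numeral)
    \<comment> \<open>The factor \<open>3 ^ s\<close> completes \<open>t * n'\<close> to the
      multiple \<open>t * n\<close> of \<open>n\<close>, which is why the comparison starts at index
      \<open>s\<close>.\<close>
    have e: "3 ^ (s + k) * (2 * m) = n * (2 * m * t) + 3 ^ s * (2 * m)"
      by (simp add: power_add t assms(5) algebra_simps)
    have "x (s + k) = p powi int (2 * m * t) * x s"
      unfolding x_def e by (simp only: power_add p_def power_int_of_nat power_mult[symmetric]) simp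
    hence "psi p (x (s + k)) = psi p (x s) + of_nat (2 * m * t)"
      using psi_lemmas(1)[OF x_nz x_theta(1), of s "int (2 * m * t)"] \<open>k > 0\<close> by simp
    moreover have "(of_nat (3 ^ (s + k) * (2 * m)) :: complex) / of_nat n =
                   of_nat (2 * m * t) + of_nat (3 ^ s * (2 * m)) / of_nat n"
      unfolding e using assms(4) by (simp add: field_simps)
    ultimately show ?thesis by (simp add: g_def)
  qed
  have sums: "(\<Sum>j = 1..s + k. 3 powi (int k - int j) / (3 ^ k - 1) * P1_fun (x (j - 1)) p)
            - (\<Sum>j = 1..s. 3 powi (- int j) / (3 ^ k - 1) * P1_fun (x (j - 1)) p) = g 0"
  proof -
    have nz: "(3::complex) ^ k - 1 \<noteq> 0"
    proof -
      have "(1::real) < 3 ^ k"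
        using \<open>k > 0\<close> by (intro one_less_power) auto
      hence "norm ((3::complex) ^ k) \<noteq> 1"
        unfolding norm_power norm_numeral by (rule less_imp_neq[symmetric])
      thus ?thesis by auto
    qed
    have 1: "(\<Sum>j = 1..s + k. 3 powi (int k - int j) / (3 ^ k - 1) * P1_fun (x (j - 1)) p) =
          3 ^ k / (3 ^ k - 1) * (\<Sum>j = 1..s + k. P1_fun (x (j - 1)) p / 3 ^ j)"
      unfolding sum_distrib_left by (intro sum.cong) (auto simp: power_int_diff)
    have 2: "(\<Sum>j = 1..s. 3 powi (- int j) / (3 ^ k - 1) * P1_fun (x (j - 1)) p) =
          1 / (3 ^ k - 1) * (\<Sum>j = 1..s. P1_fun (x (j - 1)) p / 3 ^ j)"
      unfolding sum_distrib_left by (intro sum.cong) (auto simp: power_int_minus field_simps)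
    \<comment> \<open>Both boundary terms equal \<open>g s / (3 ^ s * (3 ^ k - 1))\<close> and
      cancel; the coefficients of \<open>g 0\<close> differ by 1.\<close>
    show ?thesis
      unfolding 1 2 telescope[OF order_refl] telescope[OF le_add1] period using nz
      by (simp add: power_add divide_simps) (simp add: algebra_simps)
  qed
  define a where "a = \<epsilon> * q ^ m"
  define c where "c = - (q powi (int n - 2 * int m))"
  have c_eq: "c = p * (1 / x 0)"
    using q by (simp add: c_def x_def p_def power_int_diff power_int_mult mult.commute
        flip: power_mult)
  have aac: "a * a * c = p * (- 1)"
    using q assms(8) by (auto simp: c_eq a_def x_def mult_2 power_add)
  have "psi p a + psi p a + psi p c - psi p (a * a * c) = P_fun a a c p"
    by (rule psi_lemmas)
       (use assms(11) in \<open>auto simp: P_defined_def thetas_def a_def c_def p_def\<close>)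
  moreover have "psi p (a * a * c) = 1"
    unfolding aac using psi_minus_1[OF norm_p p_nz] by (subst psi_lemmas) auto
  moreover have "psi p c = 1 - psi p (x 0)"
    unfolding c_eq using x_theta(1)[of 0] x_nz[of 0] \<open>k > 0\<close>
    by (subst psi_lemmas) (auto simp: psi_lemmas theta_inverse[OF norm_p p_nz])
  ultimately have "2 * psi p a - psi p (x 0) = P_fun a a c p"
    by (simp only: mult_2 algebra_simps) (simp add: algebra_simps)
  hence "2 * S_fun a p + 1 = psi p (x 0) + P_fun a a c p"
    by (simp add: psi_def[OF norm_p p_nz, of a] algebra_simps)
  \<comment> \<open>Subtracting \<open>2 * m / n\<close> turns \<open>psi p (x 0)\<close> into
    \<open>g 0\<close> on the right and 1 into \<open>(n - 2 * m) / n\<close> on the left.\<close>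
  hence "2 * S_fun a p + (of_nat n - 2 * of_nat m) / of_nat n = g 0 + P_fun a a c p"
    using assms(4) by (simp add: g_def diff_divide_distrib)
  thus ?thesis
    using sums by (simp add: x_def a_def c_def p_def)
qed

end
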